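(* Let $F(x)=f(x)+\delta_C(x)+\Phi(|x|)$ be as in the context, and let $\{\theta_k\}_{k\ge 0}\subset(0,1]$ be chosen so that for some $\gamma\in(0,1)$, $$\sup_{k\ge 1}\max\left\{\frac{\theta_k^2(1-\theta_{k-1})^2}{\gamma}-\theta_{k-1}^2,\ \frac{\theta_k^2}{1-\gamma}-1\right\}<0.$$ Let $\{x^k\},\{y^k\},\{z^k\}$ be the sequences generated by the algorithm IRL$_1e_3$ described in the context, define $w^{k+1}:=(1-\theta_k)x^k+\theta_kz^{k+1}$ for $k\ge 0$, and let $$H_3(x,y,w):=f(x)+\delta_C(x)+\Phi(|x|)+\frac{L}{2}\|w-y\|^2+\frac{L}{2}\|w-x\|^2.$$ Then the following statements hold: (i) $\{H_3(x^k,x^{k-1},w^k)\}_{k\ge 1}$ is a nonincreasing convergent sequence. Moreover, there exists a positive constant $D_3$ such that for all $k\ge 1$, $$H_3(x^k,x^{k-1},w^k)-H_3(x^{k+1},x^k,w^{k+1})\ge D_3\left(\|x^{k-1}-z^k\|^2+\|w^k-x^k\|^2\right).$$ (ii) The sequence $\{x^k\}$ is bounded. (iii) $\lim_{k\to\infty}\max\{\|x^{k-1}-z^k\|,\|w^k-x^k\|,\|x^k-x^{k-1}\|,\|x^k-y^{k-1}\|\}=0$. (iv) Any accumulation point $\tilde x$ of $\{x^k\}$ is a stationary point of the problem $\min_{x\in\mathbb{R}^n}F(x)$, i.e., $0\in\partial F(\tilde x)$.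
   Context: Setting. $\mathbb{R}^n$ carries the Euclidean inner product $\langle\cdot,\cdot\rangle$ and norm $\|\cdot\|$. The function $f:\mathbb{R}^n\to\mathbb{R}$ is convex and continuously differentiable, and its gradient is Lipschitz continuous with modulus $L>0$. $C\subseteq\mathbb{R}^n$ is a nonempty closed convex set and $\delta_C$ is its indicator function ($0$ on $C$, $+\infty$ off $C$). $\Phi(y)=\sum_{i=1}^n\phi(y_i)$ for $y\in\mathbb{R}^n_+$, where $\phi:\mathbb{R}_+\to\mathbb{R}_+$ is a continuous concave function with $\phi(0)=0$ that is continuously differentiable on $(0,\infty)$ and such that the limit $\ell:=\lim_{t\downarrow 0}\phi'(t)$ exists (as a finite real number). For $x\in\mathbb{R}^n$, $|x|$ is the vector with entries $|x_i|$. It is assumed that $F(x):=f(x)+\delta_C(x)+\Phi(|x|)$ is level-bounded (all sets $\{x: F(x)\le\alpha\}$, $\alpha\in\mathbb{R}$, are bounded). Notation. $\phi'_+(t):=\lim_{h\downarrow 0}\frac{\phi(t+h)-\phi(t)}{h}$ is the right-hand derivative, and $\Phi'_+(|y|):=(\phi'_+(|y_1|),\dots,\phi'_+(|y_n|))$. For a proper function $g:\mathbb{R}^n\to(-\infty,\infty]$ and $x$ with $g(x)<\infty$, the regular subdifferential is $\hat\partial g(x)=\{\zeta:\liminf_{z\to x,z\ne x}\frac{g(z)-g(x)-\langle\zeta,z-x\rangle}{\|z-x\|}\ge 0\}$, and $\partial g(x)$ is the limiting subdifferential: the set of $\zeta$ for which there exist $x^k\to x$ with $g(x^k)\to g(x)$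 and $\zeta^k\in\hat\partial g(x^k)$ with $\zeta^k\to\zeta$; $\partial g(x)=\emptyset$ if $g(x)=\infty$. Algorithm IRL$_1e_3$. Start with $x^0,z^0\in C$ and $\{\theta_k\}\subset(0,1]$. For $k=0,1,2,\dots$ (run without termination) set $s^{k+1}=\Phi'_+(|x^k|)$, $y^k=(1-\theta_k)x^k+\theta_kz^k$, let $z^{k+1}$ be the unique minimizer over $x\in C$ of $\langle\nabla f(y^k),x-y^k\rangle+\frac{L\theta_k}{2}\|x-z^k\|^2+\sum_{i=1}^n s^{k+1}_i|x_i|$, and let $x^{k+1}$ be the unique minimizer over $y\in C$ of $\langle\nabla f(y^k),y-y^k\rangle+\frac{L}{2}\|y-y^k\|^2+\sum_{i=1}^n s^{k+1}_i|y_i|$. *)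

theory Defs
  imports "HOL-Analysis.Analysis"
begin

definition set_indicator :: "'a set \<Rightarrow> 'a \<Rightarrow> ereal" where
  "set_indicator C x = (if x \<in> C then 0 else \<infinity>)"

definition sep_sum :: "(real \<Rightarrow> real) \<Rightarrow> real ^ 'n \<Rightarrow> real" where
  "sep_sum \<phi> y = (\<Sum>i\<in>UNIV. \<phi> (y $ i))"

definition right_deriv :: "(real \<Rightarrow> real) \<Rightarrow> real \<Rightarrow> real" where
  "right_deriv \<phi> t = Lim (at_right 0) (\<lambda>h. (\<phi> (t + h) - \<phi> t) / h)"

text \<open>On vectors, \<^term>\<open>\<bar>x\<bar>\<close> is the library's componentwise absolute value.\<close>

definition right_deriv_vec :: "(real \<Rightarrow> real) \<Rightarrow> real ^ 'n \<Rightarrow> real ^ 'n" where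
  "right_deriv_vec \<phi> y = (\<chi> i. right_deriv \<phi> (y $ i))"

definition objective ::
  "(real ^ 'n \<Rightarrow> real) \<Rightarrow> (real ^ 'n) set \<Rightarrow> (real \<Rightarrow> real) \<Rightarrow> real ^ 'n \<Rightarrow> ereal" where
  "objective f C \<phi> x = ereal (f x) + set_indicator C x + ereal (sep_sum \<phi> \<bar>x\<bar>)"

definition H3 ::
  "(real ^ 'n \<Rightarrow> real) \<Rightarrow> (real ^ 'n) set \<Rightarrow> (real \<Rightarrow> real) \<Rightarrow> real
    \<Rightarrow> real ^ 'n \<Rightarrow> real ^ 'n \<Rightarrow> real ^ 'n \<Rightarrow> ereal" where
  "H3 f C \<phi> L x y w =
     ereal (f x) + set_indicator C x + ereal (sep_sum \<phi> \<bar>x\<bar>)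
     + ereal (L / 2 * (norm (w - y))\<^sup>2) + ereal (L / 2 * (norm (w - x))\<^sup>2)"

definition level_bounded :: "('a::real_normed_vector \<Rightarrow> ereal) \<Rightarrow> bool" where
  "level_bounded g \<longleftrightarrow> (\<forall>\<alpha>::real. bounded {x. g x \<le> ereal \<alpha>})"

text \<open>Both subdifferentials are empty at points where \<^term>\<open>g\<close> is not finite. For a proper
  function, which never takes the value \<^term>\<open>-\<infinity>::ereal\<close>, these are the points
  outside its domain.\<close>

definition regular_subdiff :: "('a::real_inner \<Rightarrow> ereal) \<Rightarrow> 'a \<Rightarrow> 'a set" where
  "regular_subdiff g x =
     {\<zeta>. \<bar>g x\<bar> \<noteq> \<infinity> \<and>
          0 \<le> Liminf (at x) (\<lambda>z. (g z - g x - ereal (inner \<zeta> (z - x))) / ereal (norm (z - x)))}"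

definition limiting_subdiff :: "('a::real_inner \<Rightarrow> ereal) \<Rightarrow> 'a \<Rightarrow> 'a set" where
  "limiting_subdiff g x =
     {\<zeta>. \<bar>g x\<bar> \<noteq> \<infinity> \<and>
          (\<exists>u \<eta>. u \<longlonglongrightarrow> x \<and> (\<lambda>k. g (u k)) \<longlonglongrightarrow> g x \<and>
                 (\<forall>k. \<eta> k \<in> regular_subdiff g (u k)) \<and> \<eta> \<longlonglongrightarrow> \<zeta>)}"

text \<open>The argument \<open>grad\<close> stands for the gradient of the smooth term. Uniqueness of the two
  minimizers is not part of the definition: with \<open>L > 0\<close>, \<open>\<theta> k > 0\<close> and nonnegative
  weights both subproblems are strongly convex.\<close>

definition IRL1e3 ::
  "(real ^ 'n \<Rightarrow> real ^ 'n) \<Rightarrow> real \<Rightarrow> (real ^ 'n) set \<Rightarrow> (real \<Rightarrow> real) \<Rightarrow> (nat \<Rightarrow> real)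
    \<Rightarrow> (nat \<Rightarrow> real ^ 'n) \<Rightarrow> (nat \<Rightarrow> real ^ 'n) \<Rightarrow> (nat \<Rightarrow> real ^ 'n) \<Rightarrow> (nat \<Rightarrow> real ^ 'n) \<Rightarrow> bool" where
  "IRL1e3 grad L C \<phi> \<theta> s x y z \<longleftrightarrow>
     x 0 \<in> C \<and> z 0 \<in> C \<and>
     (\<forall>k. s (Suc k) = right_deriv_vec \<phi> \<bar>x k\<bar> \<and>
          y k = (1 - \<theta> k) *\<^sub>R x k + \<theta> k *\<^sub>R z k \<and>
          is_arg_min
            (\<lambda>u. inner (grad (y k)) (u - y k) + L * \<theta> k / 2 * (norm (u - z k))\<^sup>2
                  + (\<Sum>i\<in>UNIV. s (Suc k) $ i * \<bar>u $ i\<bar>))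
            (\<lambda>u. u \<in> C) (z (Suc k)) \<and>
          is_arg_min
            (\<lambda>u. inner (grad (y k)) (u - y k) + L / 2 * (norm (u - y k))\<^sup>2
                  + (\<Sum>i\<in>UNIV. s (Suc k) $ i * \<bar>u $ i\<bar>))
            (\<lambda>u. u \<in> C) (x (Suc k)))"

end

theory Submission
  imports Defs
begin

text \<open>Concavity of \<open>\<phi>\<close> turns the penalty into a weighted \<open>l\<^sub>1\<close> norm: the right derivative is a
  supergradient, so \<open>\<Phi>(|u|) \<le> \<Phi>(|x\<^sup>k|) + \<Sum>\<^sub>i s\<^sub>i (|u\<^sub>i| - |x\<^sup>k\<^sub>i|)\<close> with the nonnegative weights
  \<open>s = \<Phi>'\<^sub>+(|x\<^sup>k|)\<close> (\<open>sep_sum_majorized\<close>). One iteration is therefore a step of an accelerated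
  proximal gradient method for the convex function \<open>f + \<Sum>\<^sub>i s\<^sub>i |u\<^sub>i|\<close> over \<open>C\<close>.

  Both subproblems are strongly convex, so a competitor's value exceeds the minimal one by a
  quadratic (\<open>proximal_minimizer_growth\<close>). Compare \<open>z\<^sup>k\<^sup>+\<^sup>1\<close> with \<open>x\<^sup>k\<close> in the first subproblem and
  \<open>x\<^sup>k\<^sup>+\<^sup>1\<close> with \<open>w\<^sup>k\<^sup>+\<^sup>1\<close> in the second. Since \<open>w\<^sup>k\<^sup>+\<^sup>1\<close> is the convex combination of \<open>x\<^sup>k\<close> and
  \<open>z\<^sup>k\<^sup>+\<^sup>1\<close> with weight \<open>\<theta>\<^sub>k\<close>, adding \<open>\<theta>\<^sub>k\<close> times the first comparison to the second makes all
  values at \<open>z\<^sup>k\<^sup>+\<^sup>1\<close> cancel, and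
  \<open>H\<^sub>3(x\<^sup>k\<^sup>+\<^sup>1, x\<^sup>k, w\<^sup>k\<^sup>+\<^sup>1) \<le> F(x\<^sup>k) + (L/2) \<theta>\<^sub>k\<^sup>2 \<parallel>x\<^sup>k - z\<^sup>k\<parallel>\<^sup>2\<close> remains
  (\<open>accelerated_step_decrease\<close>). As \<open>w\<^sup>k - z\<^sup>k = (1 - \<theta>\<^sub>k\<^sub>-\<^sub>1) (x\<^sup>k\<^sup>-\<^sup>1 - z\<^sup>k)\<close>, splitting \<open>x\<^sup>k - z\<^sup>k\<close>
  at \<open>w\<^sup>k\<close> with the weights \<open>1/(1-\<gamma>)\<close> and \<open>1/\<gamma>\<close> bounds the last term by the two quadratics
  already present in \<open>H\<^sub>3(x\<^sup>k, x\<^sup>k\<^sup>-\<^sup>1, w\<^sup>k)\<close>; the surplus coefficients are exactly the two terms of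
  the condition on \<open>\<theta>\<close>. This yields sufficient decrease with
  \<open>D\<^sub>3 = -(L/2) sup max {\<dots>}\<close>, and boundedness, convergence of \<open>H\<^sub>3\<close> and the vanishing of all
  increments follow from level-boundedness and telescoping.

  For stationarity, minimality of \<open>x\<^sup>k\<^sup>+\<^sup>1\<close> passes to an accumulation point \<open>a\<close> because \<open>\<phi>'\<^sub>+\<close> is
  continuous on the closed half-line (\<open>proximal_step_limit\<close>): \<open>a\<close> minimizes its own proximal model
  over \<open>C\<close>. As \<open>u\<close> tends to \<open>a\<close>, the increase of that model from \<open>a\<close> to \<open>u\<close> exceeds the increase
  of \<open>f + \<Phi>(|\<cdot>|)\<close> by at most \<open>o(\<parallel>u - a\<parallel>)\<close>, so \<open>0\<close> is a regular subgradient of \<open>F\<close> at \<open>a\<close>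
  (\<open>regular_stationary\<close>), hence a limiting one.\<close>

section \<open>Smooth convex functions and proximal minimizers\<close>

definition weighted_l1 :: "real ^ 'n \<Rightarrow> real ^ 'n \<Rightarrow> real" where
  "weighted_l1 \<sigma> u = (\<Sum>i\<in>UNIV. \<sigma> $ i * \<bar>u $ i\<bar>)"

lemma convex_on_weighted_l1:
  fixes \<sigma> :: "real ^ 'n"
  assumes "\<And>i. 0 \<le> \<sigma> $ i" and "convex S"
  shows "convex_on S (weighted_l1 \<sigma>)"
proof (rule convex_onI)
  fix t :: real and u v :: "real ^ 'n"
  assume t: "0 < t" "t < 1"
  have "\<sigma> $ i * \<bar>((1 - t) *\<^sub>R u + t *\<^sub>R v) $ i\<bar>
      \<le> (1 - t) * (\<sigma> $ i * \<bar>u $ i\<bar>) + t * (\<sigma> $ i * \<bar>v $ i\<bar>)" for i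
  proof -
    have "\<bar>(1 - t) * u $ i + t * v $ i\<bar> \<le> (1 - t) * \<bar>u $ i\<bar> + t * \<bar>v $ i\<bar>"
      using t abs_triangle_ineq[of "(1 - t) * u $ i" "t * v $ i"] by (simp add: abs_mult)
    from mult_left_mono[OF this assms(1)[of i]] show ?thesis
      by (simp add: algebra_simps)
  qed
  then show "weighted_l1 \<sigma> ((1 - t) *\<^sub>R u + t *\<^sub>R v) \<le> (1 - t) * weighted_l1 \<sigma> u + t * weighted_l1 \<sigma> v"
    unfolding weighted_l1_def sum_distrib_left sum.distrib[symmetric] by (intro sum_mono)
qed (rule assms(2))

lemma gradient_along_line:
  fixes f :: "'a::real_inner \<Rightarrow> real"
  assumes "\<And>u. GDERIV f u :> grad u"
  shows "((\<lambda>t. f (a + t *\<^sub>R d)) has_real_derivative inner (grad (a + t *\<^sub>R d)) d) (at t)"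
proof -
  have "((\<lambda>t. a + t *\<^sub>R d) has_derivative (\<lambda>h. h *\<^sub>R d)) (at t)"
    by (auto intro!: derivative_eq_intros)
  from has_derivative_compose[OF this assms[unfolded gderiv_def]]
  show ?thesis
    by (simp add: has_field_derivative_def mult_commute_abs inner_commute)
qed

text \<open>Restricted to the line through \<open>a\<close> and \<open>u\<close>, \<open>f\<close> is convex on the reals and lies above its tangent.\<close>

lemma convex_gradient_inequality:
  fixes f :: "'a::real_inner \<Rightarrow> real"
  assumes cvx: "convex_on UNIV f" and grad: "\<And>u. GDERIV f u :> grad u"
  shows "f a + inner (grad a) (u - a) \<le> f u"
proof -
  define g where "g t = f (a + t *\<^sub>R (u - a))" for t
  have "convex_on UNIV g"
  proof (rule convex_onI)
    fix t p q :: real assume t: "0 < t" "t < 1"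
    have "a + ((1 - t) *\<^sub>R p + t *\<^sub>R q) *\<^sub>R (u - a)
        = (1 - t) *\<^sub>R (a + p *\<^sub>R (u - a)) + t *\<^sub>R (a + q *\<^sub>R (u - a))"
      by (simp add: algebra_simps)
    then show "g ((1 - t) *\<^sub>R p + t *\<^sub>R q) \<le> (1 - t) * g p + t * g q"
      unfolding g_def using convex_onD[OF cvx, of t] t by simp
  qed simp
  moreover have "(g has_real_derivative inner (grad a) (u - a)) (at 0)"
    using gradient_along_line[OF grad, of a "u - a" 0] by (simp add: g_def[abs_def])
  ultimately have "g 1 - g 0 \<ge> inner (grad a) (u - a) * (1 - 0)"
    by (intro convex_on_imp_above_tangent[of UNIV]) auto
  then show ?thesis by (simp add: g_def)
qed

text \<open>Along the segment from \<open>a\<close> to \<open>u\<close>, the difference between \<open>f\<close> and its quadratic model has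
  nonpositive derivative, by Cauchy--Schwarz and the Lipschitz bound on the gradient.\<close>

lemma descent_lemma:
  fixes f :: "'a::real_inner \<Rightarrow> real"
  assumes grad: "\<And>u. GDERIV f u :> grad u" and lip: "L-lipschitz_on UNIV grad"
  shows "f u \<le> f a + inner (grad a) (u - a) + L / 2 * (norm (u - a))\<^sup>2"
proof -
  define d where "d = u - a"
  define g where "g t = f (a + t *\<^sub>R d) - t * inner (grad a) d - L / 2 * t\<^sup>2 * (norm d)\<^sup>2" for t
  have "g 1 \<le> g 0"
  proof (rule DERIV_nonpos_imp_nonincreasing[of 0 1])
    fix t :: real assume t: "0 \<le> t" "t \<le> 1"
    have "inner (grad (a + t *\<^sub>R d) - grad a) d \<le> norm (grad (a + t *\<^sub>R d) - grad a) * norm d"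
      by (rule norm_cauchy_schwarz)
    also have "\<dots> \<le> (L * (t * norm d)) * norm d"
      using lipschitz_onD[OF lip, of "a + t *\<^sub>R d" a] t
      by (intro mult_right_mono) (auto simp: dist_norm)
    finally have "inner (grad (a + t *\<^sub>R d)) d - inner (grad a) d - L * t * (norm d)\<^sup>2 \<le> 0"
      by (simp add: inner_diff_left power2_eq_square mult.assoc)
    moreover have "(g has_real_derivative
        inner (grad (a + t *\<^sub>R d)) d - inner (grad a) d - L * t * (norm d)\<^sup>2) (at t)"
      unfolding g_def by (auto intro!: derivative_eq_intros gradient_along_line[OF grad])
    ultimately show "\<exists>e. (g has_real_derivative e) (at t) \<and> e \<le> 0" by blast
  qed simp_all
  then show ?thesis by (simp add: g_def d_def)
qed

text \<open>Move from the minimizer \<open>p\<close> a fraction \<open>t\<close> of the way towards \<open>u\<close>. The quadratic part of the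
  objective falls below its chord by exactly \<open>(M/2) t (1 - t) \<parallel>u - p\<parallel>\<^sup>2\<close>, while minimality of \<open>p\<close> keeps
  the value from decreasing. Dividing by \<open>t\<close> and letting \<open>t\<close> tend to \<open>0\<close> gives the growth term.\<close>

lemma proximal_minimizer_growth:
  fixes h :: "'a::real_inner \<Rightarrow> real"
  assumes cvx: "convex_on S h"
    and min: "is_arg_min (\<lambda>u. h u + M / 2 * (norm (u - v))\<^sup>2) (\<lambda>u. u \<in> S) p"
    and u: "u \<in> S"
  shows "h p + M / 2 * (norm (p - v))\<^sup>2 + M / 2 * (norm (u - p))\<^sup>2
    \<le> h u + M / 2 * (norm (u - v))\<^sup>2"
proof -
  define G where "G u = h u + M / 2 * (norm (u - v))\<^sup>2" for u
  have p: "p \<in> S" and Gp: "\<And>q. q \<in> S \<Longrightarrow> G p \<le> G q"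
    using min by (auto simp: is_arg_min_def G_def not_less)
  have S: "convex S" using cvx by (rule convex_on_imp_convex)
  have key: "M / 2 * (1 - t) * (norm (u - p))\<^sup>2 \<le> G u - G p" if t: "0 < t" "t < 1" for t
  proof -
    let ?q = "(1 - t) *\<^sub>R p + t *\<^sub>R u"
    have q: "?q \<in> S" using S p u t by (intro convexD) auto
    have sq: "(norm (?q - v))\<^sup>2
        = (1 - t) * (norm (p - v))\<^sup>2 + t * (norm (u - v))\<^sup>2 - t * (1 - t) * (norm (u - p))\<^sup>2"
    proof -
      define A B where "A = p - v" and "B = u - v"
      have *: "?q - v = (1 - t) *\<^sub>R A + t *\<^sub>R B" "u - p = B - A"
        by (simp_all add: A_def B_def algebra_simps)
      show ?thesis
        unfolding * A_def[symmetric] B_def[symmetric] power2_norm_eq_inner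
        by (simp add: inner_add_left inner_add_right inner_diff_left inner_diff_right
            inner_commute[of B A] field_simps power2_eq_square)
    qed
    have "h ?q \<le> (1 - t) * h p + t * h u"
      using convex_onD[OF cvx, of t p u] t p u by simp
    then have "G ?q \<le> (1 - t) * G p + t * G u - M / 2 * (t * (1 - t) * (norm (u - p))\<^sup>2)"
      unfolding G_def sq by (simp add: algebra_simps add_divide_distrib diff_divide_distrib)
    with Gp[OF q] have "G p \<le> (1 - t) * G p + t * G u - t * (M / 2 * (1 - t) * (norm (u - p))\<^sup>2)"
      by (simp add: mult_ac)
    then have "t * (M / 2 * (1 - t) * (norm (u - p))\<^sup>2) \<le> t * (G u - G p)"
      by (simp add: left_diff_distrib right_diff_distrib)
    then show ?thesis using t by simp
  qed
  have "((\<lambda>t. M / 2 * (1 - t) * (norm (u - p))\<^sup>2) \<longlongrightarrow> M / 2 * (1 - 0) * (norm (u - p))\<^sup>2) (at_right 0)"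
    by (intro tendsto_intros)
  moreover have "eventually (\<lambda>t. M / 2 * (1 - t) * (norm (u - p))\<^sup>2 \<le> G u - G p) (at_right 0)"
    using eventually_at_right_real[OF zero_less_one]
    by eventually_elim (use key in auto)
  ultimately have "M / 2 * (1 - 0) * (norm (u - p))\<^sup>2 \<le> G u - G p"
    by (intro tendsto_upperbound) auto
  then show ?thesis by (simp add: G_def)
qed

section \<open>One accelerated step\<close>

text \<open>The estimate behind the decrease of \<open>H\<^sub>3\<close>. The factor \<open>\<theta>\<close> in the proximal weight of the
  first subproblem is chosen so that, after multiplication by \<open>\<theta>\<close>, its quadratic
  \<open>L \<theta>\<^sup>2 \<parallel>z' - z\<parallel>\<^sup>2 / 2\<close> equals the quadratic \<open>L \<parallel>w' - y\<parallel>\<^sup>2 / 2\<close> that the competitor \<open>w'\<close> pays in the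
  second; both cancel, and only distances from \<open>x\<close> survive.\<close>

lemma accelerated_step_decrease:
  fixes f :: "real ^ 'n \<Rightarrow> real"
  assumes f_cvx: "convex_on UNIV f" and grad: "\<And>u. GDERIV f u :> grad u"
    and lip: "L-lipschitz_on UNIV grad"
    and C: "convex C" and x: "x \<in> C" and \<sigma>: "\<And>i. 0 \<le> \<sigma> $ i"
    and \<theta>: "0 \<le> \<theta>" "\<theta> \<le> 1"
    and y: "y = (1 - \<theta>) *\<^sub>R x + \<theta> *\<^sub>R z"
    and z': "is_arg_min (\<lambda>u. inner (grad y) (u - y) + L * \<theta> / 2 * (norm (u - z))\<^sup>2 + weighted_l1 \<sigma> u)
               (\<lambda>u. u \<in> C) z'"
    and x': "is_arg_min (\<lambda>u. inner (grad y) (u - y) + L / 2 * (norm (u - y))\<^sup>2 + weighted_l1 \<sigma> u)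
               (\<lambda>u. u \<in> C) x'"
    and w': "w' = (1 - \<theta>) *\<^sub>R x + \<theta> *\<^sub>R z'"
  shows "f x' + weighted_l1 \<sigma> x' + L / 2 * (norm (w' - x))\<^sup>2 + L / 2 * (norm (w' - x'))\<^sup>2
    \<le> f x + weighted_l1 \<sigma> x + L / 2 * (\<theta>\<^sup>2 * (norm (x - z))\<^sup>2)"
proof -
  define h where "h u = inner (grad y) (u - y) + weighted_l1 \<sigma> u" for u
  have "convex_on C (\<lambda>u. inner (grad y) (u - y))"
    by (rule convex_onI[OF _ C]) (simp add: algebra_simps inner_diff_right inner_add_right)
  then have h_cvx: "convex_on C h"
    unfolding h_def using convex_on_weighted_l1[OF \<sigma> C] by (rule convex_on_add)
  have z'C: "z' \<in> C" using z' by (simp add: is_arg_min_def)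
  have w'C: "w' \<in> C" unfolding w' using C x z'C \<theta> by (intro convexD) auto
  have zmin: "h z' + L * \<theta> / 2 * (norm (z' - z))\<^sup>2 + L * \<theta> / 2 * (norm (x - z'))\<^sup>2
      \<le> h x + L * \<theta> / 2 * (norm (x - z))\<^sup>2"
    by (rule proximal_minimizer_growth[OF h_cvx _ x])
      (use z' in \<open>auto simp: h_def algebra_simps\<close>)
  have xmin: "h x' + L / 2 * (norm (x' - y))\<^sup>2 + L / 2 * (norm (w' - x'))\<^sup>2
      \<le> h w' + L / 2 * (norm (w' - y))\<^sup>2"
    by (rule proximal_minimizer_growth[OF h_cvx _ w'C])
      (use x' in \<open>auto simp: h_def algebra_simps\<close>)
  have hw: "h w' \<le> (1 - \<theta>) * h x + \<theta> * h z'"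
    unfolding w' using convex_onD[OF h_cvx, of \<theta> x z'] \<theta> x z'C by simp
  have "w' - y = \<theta> *\<^sub>R (z' - z)" "w' - x = \<theta> *\<^sub>R (z' - x)"
    by (simp_all add: w' y algebra_simps)
  then have wy: "(norm (w' - y))\<^sup>2 = \<theta>\<^sup>2 * (norm (z' - z))\<^sup>2"
    and wx: "(norm (w' - x))\<^sup>2 = \<theta>\<^sup>2 * (norm (x - z'))\<^sup>2"
    by (simp_all add: power_mult_distrib norm_minus_commute)
  have "\<theta> * (h z' + L * \<theta> / 2 * (norm (z' - z))\<^sup>2 + L * \<theta> / 2 * (norm (x - z'))\<^sup>2)
      \<le> \<theta> * (h x + L * \<theta> / 2 * (norm (x - z))\<^sup>2)"
    using zmin \<theta> by (intro mult_left_mono) auto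
  then have "\<theta> * h z' + L / 2 * (norm (w' - y))\<^sup>2 + L / 2 * (norm (w' - x))\<^sup>2
      \<le> \<theta> * h x + L / 2 * (\<theta>\<^sup>2 * (norm (x - z))\<^sup>2)"
    unfolding wy wx by (simp add: algebra_simps power2_eq_square)
  with xmin hw have "h x' + L / 2 * (norm (x' - y))\<^sup>2 + L / 2 * (norm (w' - x'))\<^sup>2
      + L / 2 * (norm (w' - x))\<^sup>2 \<le> h x + L / 2 * (\<theta>\<^sup>2 * (norm (x - z))\<^sup>2)"
    by (simp add: algebra_simps)
  moreover have "f x' \<le> f y + inner (grad y) (x' - y) + L / 2 * (norm (x' - y))\<^sup>2"
    by (rule descent_lemma[OF grad lip])
  moreover have "f y + inner (grad y) (x - y) \<le> f x"
    by (rule convex_gradient_inequality[OF f_cvx grad])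
  ultimately show ?thesis by (simp add: h_def)
qed

section \<open>Concave penalties on the half-line\<close>

locale concave_penalty =
  fixes \<phi> :: "real \<Rightarrow> real" and l :: real
  assumes nonneg: "\<And>t. t \<ge> 0 \<Longrightarrow> \<phi> t \<ge> 0"
    and cont: "continuous_on {0..} \<phi>"
    and concave: "concave_on {0..} \<phi>"
    and diff: "\<And>t. t > 0 \<Longrightarrow> \<phi> field_differentiable at t"
    and deriv_cont: "continuous_on {0<..} (deriv \<phi>)"
    and deriv_lim: "(deriv \<phi> \<longlongrightarrow> l) (at_right 0)"
begin

lemma tangent_above_pos:
  assumes "0 < a" "0 \<le> b"
  shows "\<phi> b \<le> \<phi> a + deriv \<phi> a * (b - a)"
proof -
  have "((\<lambda>t. - \<phi> t) has_real_derivative - deriv \<phi> a) (at a within {0..})"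
    using DERIV_minus[OF field_differentiable_derivI[OF diff[OF assms(1)]]]
    by (rule has_field_derivative_at_within)
  then have "- \<phi> b - (- \<phi> a) \<ge> - deriv \<phi> a * (b - a)"
    using concave assms unfolding concave_on_def
    by (intro convex_on_imp_above_tangent[of "{0..}"]) auto
  then show ?thesis by simp
qed

text \<open>The tangent inequality at \<open>a > 0\<close> survives the limit \<open>a \<rightarrow> 0\<close>, as both \<open>\<phi>\<close> and its derivative
  have limits there.\<close>

lemma tangent_above_zero:
  assumes "0 \<le> b"
  shows "\<phi> b \<le> \<phi> 0 + l * b"
proof -
  have "(\<phi> \<longlongrightarrow> \<phi> 0) (at 0 within {0..})"
    using cont by (simp add: continuous_on_def)
  then have "(\<phi> \<longlongrightarrow> \<phi> 0) (at_right 0)"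
    by (rule tendsto_within_subset) auto
  then have "((\<lambda>a. \<phi> a + deriv \<phi> a * (b - a)) \<longlongrightarrow> \<phi> 0 + l * (b - 0)) (at_right 0)"
    by (intro tendsto_intros deriv_lim)
  moreover have "eventually (\<lambda>a. \<phi> b \<le> \<phi> a + deriv \<phi> a * (b - a)) (at_right 0)"
    using eventually_at_right_less[of "0::real"]
    by eventually_elim (use tangent_above_pos assms in auto)
  ultimately have "\<phi> b \<le> \<phi> 0 + l * (b - 0)"
    by (intro tendsto_lowerbound) auto
  then show ?thesis by simp
qed

text \<open>The difference quotient at \<open>0\<close> is squeezed between \<open>\<phi>'(h)\<close>, by the tangent at \<open>h\<close> evaluated in
  \<open>0\<close>, and \<open>l\<close>, by the tangent at \<open>0\<close> evaluated in \<open>h\<close>.\<close>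

lemma right_quotient_tendsto_zero: "((\<lambda>h. (\<phi> (0 + h) - \<phi> 0) / h) \<longlongrightarrow> l) (at_right 0)"
proof (rule tendsto_sandwich[OF _ _ deriv_lim tendsto_const])
  show "eventually (\<lambda>h. deriv \<phi> h \<le> (\<phi> (0 + h) - \<phi> 0) / h) (at_right 0)"
    using eventually_at_right_less[of "0::real"]
  proof eventually_elim
    case (elim h)
    then show ?case using tangent_above_pos[of h 0] by (simp add: pos_le_divide_eq)
  qed
  show "eventually (\<lambda>h. (\<phi> (0 + h) - \<phi> 0) / h \<le> l) (at_right 0)"
    using eventually_at_right_less[of "0::real"]
  proof eventually_elim
    case (elim h)
    then show ?case using tangent_above_zero[of h] by (simp add: pos_divide_le_eq)
  qed
qed

lemma right_deriv_zero: "right_deriv \<phi> 0 = l"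
  unfolding right_deriv_def by (rule tendsto_Lim[OF _ right_quotient_tendsto_zero]) simp

lemma right_deriv_pos:
  assumes "0 < t"
  shows "right_deriv \<phi> t = deriv \<phi> t"
proof -
  have "(\<phi> has_real_derivative deriv \<phi> t) (at t)"
    using field_differentiable_derivI[OF diff[OF assms]] .
  then have "((\<lambda>h. (\<phi> (t + h) - \<phi> t) / h) \<longlongrightarrow> deriv \<phi> t) (at 0)"
    by (simp add: DERIV_def)
  then have "((\<lambda>h. (\<phi> (t + h) - \<phi> t) / h) \<longlongrightarrow> deriv \<phi> t) (at_right 0)"
    by (rule tendsto_within_subset) auto
  then show ?thesis
    unfolding right_deriv_def by (intro tendsto_Lim) simp
qed

lemma tangent_above:
  assumes "0 \<le> a" "0 \<le> b"
  shows "\<phi> b \<le> \<phi> a + right_deriv \<phi> a * (b - a)"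
  using tangent_above_pos[of a b] tangent_above_zero[of b] assms
  by (cases "a = 0") (auto simp: right_deriv_zero right_deriv_pos)

text \<open>A concave function with a negative slope somewhere would eventually become negative.\<close>

lemma right_deriv_nonneg:
  assumes "0 \<le> a"
  shows "0 \<le> right_deriv \<phi> a"
proof (rule ccontr)
  assume "\<not> ?thesis"
  then have neg: "right_deriv \<phi> a < 0" by simp
  \<comment> \<open>the point where the tangent at \<open>a\<close> takes the value \<open>-1\<close>\<close>
  define b where "b = a + (\<phi> a + 1) / (- right_deriv \<phi> a)"
  have "(\<phi> a + 1) / (- right_deriv \<phi> a) \<ge> 0"
    using neg nonneg[OF assms] by (intro divide_nonneg_pos) auto
  then have "b \<ge> 0" unfolding b_def using assms by simp
  moreover have "right_deriv \<phi> a * (b - a) = - (\<phi> a + 1)"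
    using neg by (simp add: b_def field_simps)
  ultimately show False
    using tangent_above[OF assms, of b] nonneg[of b] by simp
qed

text \<open>Working within the closed half-line lets coordinates that vanish be treated like the others:
  the penalty evaluates \<open>\<phi>\<close> only at moduli \<open>|u\<^sub>i| \<ge> 0\<close>, so one-sided information at \<open>0\<close> suffices.\<close>

lemma has_right_deriv_within:
  assumes "0 \<le> t"
  shows "(\<phi> has_real_derivative right_deriv \<phi> t) (at t within {0..})"
proof (cases "t = 0")
  case True
  have "at (0::real) within {0..} = at_right 0"
    by (metis at_within_Ici_at_right)
  then show ?thesis
    using right_quotient_tendsto_zero True
    by (simp add: has_field_derivative_iff right_deriv_zero)
next
  case False
  then show ?thesis
    using field_differentiable_derivI[OF diff, of t] assms
    by (auto simp: right_deriv_pos intro: has_field_derivative_at_within)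
qed

lemma continuous_on_right_deriv: "continuous_on {0..} (right_deriv \<phi>)"
  unfolding continuous_on_def
proof
  fix t :: real assume "t \<in> {0..}"
  show "(right_deriv \<phi> \<longlongrightarrow> right_deriv \<phi> t) (at t within {0..})"
  proof (cases "t = 0")
    case True
    have "eventually (\<lambda>h. deriv \<phi> h = right_deriv \<phi> h) (at_right 0)"
      using eventually_at_right_less[of "0::real"]
      by eventually_elim (simp add: right_deriv_pos)
    from tendsto_cong[THEN iffD1, OF this deriv_lim]
    show ?thesis using True by (simp add: at_within_Ici_at_right right_deriv_zero)
  next
    case False
    with \<open>t \<in> {0..}\<close> have t: "t \<in> {0<..}" by simp
    have "continuous_on {0<..} (right_deriv \<phi>)"
      using deriv_cont by (rule continuous_on_cong[THEN iffD1, rotated -1]) (auto simp: right_deriv_pos)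
    then have "isCont (right_deriv \<phi>) t"
      using t by (simp add: continuous_on_eq_continuous_at)
    then show ?thesis
      by (metis isCont_def tendsto_within_subset subset_UNIV)
  qed
qed

text \<open>The reweighting principle: linearizing \<open>\<phi>\<close> at the moduli of \<open>v\<close> never underestimates the increase
  of the penalty, so a decrease of the reweighted model is inherited by the objective.\<close>

lemma sep_sum_majorized:
  "sep_sum \<phi> \<bar>u\<bar> + weighted_l1 (right_deriv_vec \<phi> \<bar>v\<bar>) v
    \<le> sep_sum \<phi> \<bar>v\<bar> + weighted_l1 (right_deriv_vec \<phi> \<bar>v\<bar>) u"
proof -
  have "\<phi> \<bar>u $ i\<bar> + right_deriv \<phi> \<bar>v $ i\<bar> * \<bar>v $ i\<bar> \<le> \<phi> \<bar>v $ i\<bar> + right_deriv \<phi> \<bar>v $ i\<bar> * \<bar>u $ i\<bar>" for i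
    using tangent_above[of "\<bar>v $ i\<bar>" "\<bar>u $ i\<bar>"] by (simp add: algebra_simps)
  then show ?thesis
    unfolding sep_sum_def weighted_l1_def right_deriv_vec_def sum.distrib[symmetric]
    by (simp add: sum_mono abs_vec_def)
qed

section \<open>Stationarity of fixed points of the proximal step\<close>

text \<open>First-order expansion of the penalty from below, with \<open>\<epsilon> \<parallel>u - a\<parallel>\<close> in place of \<open>o(\<parallel>u - a\<parallel>)\<close>. The
  function \<open>|u\<^sub>i|\<close> is not linearized, so the expansion also holds at coordinates where \<open>a\<^sub>i = 0\<close>.\<close>

lemma sep_sum_expansion:
  fixes a :: "real ^ 'n"
  assumes "0 < \<epsilon>"
  shows "eventually (\<lambda>u. sep_sum \<phi> \<bar>a\<bar> + weighted_l1 (right_deriv_vec \<phi> \<bar>a\<bar>) u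
      - weighted_l1 (right_deriv_vec \<phi> \<bar>a\<bar>) a - \<epsilon> * norm (u - a) \<le> sep_sum \<phi> \<bar>u\<bar>) (at a)"
proof -
  define n where "n = real CARD('n)"
  have n: "0 < n" by (simp add: n_def)
  have "eventually (\<lambda>u. \<phi> \<bar>a $ i\<bar> + right_deriv \<phi> \<bar>a $ i\<bar> * \<bar>u $ i\<bar> - right_deriv \<phi> \<bar>a $ i\<bar> * \<bar>a $ i\<bar>
      - \<epsilon> / n * norm (u - a) \<le> \<phi> \<bar>u $ i\<bar>) (at a)" for i
  proof -
    have "(\<phi> has_derivative (*) (right_deriv \<phi> \<bar>a $ i\<bar>)) (at \<bar>a $ i\<bar> within {0..})"
      using has_right_deriv_within[of "\<bar>a $ i\<bar>"] by (simp add: has_field_derivative_def)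
    then obtain \<delta> where \<delta>: "0 < \<delta>" and
      near: "\<And>t. 0 \<le> t \<Longrightarrow> \<bar>t - \<bar>a $ i\<bar>\<bar> < \<delta> \<Longrightarrow>
        \<bar>\<phi> t - \<phi> \<bar>a $ i\<bar> - right_deriv \<phi> \<bar>a $ i\<bar> * (t - \<bar>a $ i\<bar>)\<bar> \<le> \<epsilon> / n * \<bar>t - \<bar>a $ i\<bar>\<bar>"
      unfolding has_derivative_within_alt using assms n
      by (metis atLeast_iff divide_pos_pos real_norm_def)
    have "eventually (\<lambda>u. dist u a < \<delta>) (at a)"
      using \<delta> by (auto simp: eventually_at)
    then show ?thesis
    proof eventually_elim
      case (elim u)
      have close: "\<bar>\<bar>u $ i\<bar> - \<bar>a $ i\<bar>\<bar> \<le> norm (u - a)"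
        using component_le_norm_cart[of "u - a" i] by simp
      then have "\<bar>\<phi> \<bar>u $ i\<bar> - \<phi> \<bar>a $ i\<bar> - right_deriv \<phi> \<bar>a $ i\<bar> * (\<bar>u $ i\<bar> - \<bar>a $ i\<bar>)\<bar>
          \<le> \<epsilon> / n * \<bar>\<bar>u $ i\<bar> - \<bar>a $ i\<bar>\<bar>"
        using elim by (intro near) (auto simp: dist_norm)
      also have "\<dots> \<le> \<epsilon> / n * norm (u - a)"
        using close assms n by (intro mult_left_mono) auto
      finally show ?case by (simp add: right_diff_distrib abs_le_iff)
    qed
  qed
  then have "eventually (\<lambda>u. \<forall>i. \<phi> \<bar>a $ i\<bar> + right_deriv \<phi> \<bar>a $ i\<bar> * \<bar>u $ i\<bar>
      - right_deriv \<phi> \<bar>a $ i\<bar> * \<bar>a $ i\<bar> - \<epsilon> / n * norm (u - a) \<le> \<phi> \<bar>u $ i\<bar>) (at a)"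
    by (simp add: eventually_all_finite)
  then show ?thesis
  proof eventually_elim
    case (elim u)
    have "(\<Sum>i\<in>UNIV. \<phi> \<bar>a $ i\<bar> + right_deriv \<phi> \<bar>a $ i\<bar> * \<bar>u $ i\<bar>
        - right_deriv \<phi> \<bar>a $ i\<bar> * \<bar>a $ i\<bar> - \<epsilon> / n * norm (u - a)) \<le> (\<Sum>i\<in>UNIV. \<phi> \<bar>u $ i\<bar>)"
      using elim by (intro sum_mono) auto
    then show ?case
      using n by (simp add: sep_sum_def weighted_l1_def right_deriv_vec_def abs_vec_def
          sum.distrib sum_subtractf n_def)
  qed
qed

text \<open>The hypothesis \<open>min\<close> says that \<open>a\<close> minimizes its own proximal model over \<open>C\<close>. Convexity of \<open>f\<close> and
  the expansion of the penalty show that on \<open>C\<close> the objective increases at least as much as the model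
  does, up to \<open>\<epsilon> \<parallel>u - a\<parallel>\<close> and the quadratic term of the model. Both are \<open>o(\<parallel>u - a\<parallel>)\<close> as \<open>\<epsilon>\<close> is
  arbitrary, so the difference quotients have nonnegative lower limit.\<close>

lemma regular_stationary:
  fixes f :: "real ^ 'n \<Rightarrow> real"
  assumes f_cvx: "convex_on UNIV f" and grad: "\<And>u. GDERIV f u :> grad u" and L: "0 < L"
    and a: "a \<in> C"
    and min: "\<And>u. u \<in> C \<Longrightarrow> weighted_l1 (right_deriv_vec \<phi> \<bar>a\<bar>) a
      \<le> inner (grad a) (u - a) + L / 2 * (norm (u - a))\<^sup>2 + weighted_l1 (right_deriv_vec \<phi> \<bar>a\<bar>) u"
  shows "0 \<in> regular_subdiff (objective f C \<phi>) a"
proof -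
  let ?Q = "\<lambda>u. (objective f C \<phi> u - objective f C \<phi> a - ereal (inner 0 (u - a))) / ereal (norm (u - a))"
  have "eventually (\<lambda>u. c < ?Q u) (at a)" if "c < 0" for c :: ereal
  proof -
    obtain r where r: "c < ereal r" "ereal r < 0"
      using ereal_dense2[OF \<open>c < 0\<close>] by auto
    \<comment> \<open>one \<open>\<epsilon>\<close> pays for the penalty expansion, the other for the quadratic term\<close>
    define \<epsilon> where "\<epsilon> = - r / 2"
    have \<epsilon>: "0 < \<epsilon>" using r by (simp add: \<epsilon>_def)
    have "eventually (\<lambda>u. dist u a < 2 * \<epsilon> / L \<and> u \<noteq> a) (at a)"
      using \<epsilon> L by (auto simp: eventually_at intro!: exI[of _ "2 * \<epsilon> / L"])
    with sep_sum_expansion[OF \<epsilon>, of a] show ?thesis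
    proof eventually_elim
      case (elim u)
      define d where "d = norm (u - a)"
      have d: "0 < d" "L / 2 * d \<le> \<epsilon>"
        using elim L by (auto simp: d_def dist_norm field_simps)
      show ?case
      proof (cases "u \<in> C")
        case True
        have "L / 2 * d\<^sup>2 \<le> \<epsilon> * d"
          using mult_right_mono[OF d(2), of d] d(1) by (simp add: power2_eq_square)
        then have "r * d \<le> (f u + sep_sum \<phi> \<bar>u\<bar>) - (f a + sep_sum \<phi> \<bar>a\<bar>)"
          using min[OF True] convex_gradient_inequality[OF f_cvx grad, of a u] elim
          by (simp add: \<epsilon>_def flip: d_def)
        then have "r \<le> ((f u + sep_sum \<phi> \<bar>u\<bar>) - (f a + sep_sum \<phi> \<bar>a\<bar>)) / d"
          using d by (simp add: pos_le_divide_eq)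
        moreover have "?Q u = ereal (((f u + sep_sum \<phi> \<bar>u\<bar>) - (f a + sep_sum \<phi> \<bar>a\<bar>)) / d)"
          using True a d by (simp add: objective_def set_indicator_def flip: d_def)
        ultimately show ?thesis using r(1) by (simp add: order_less_le_trans)
      next
        case False
        then have "?Q u = \<infinity>"
          using a d by (simp add: objective_def set_indicator_def divide_ereal_def flip: d_def)
        then show ?thesis using r by (auto intro: less_trans)
      qed
    qed
  qed
  then have "0 \<le> Liminf (at a) ?Q"
    by (simp add: le_Liminf_iff)
  moreover have "\<bar>objective f C \<phi> a\<bar> \<noteq> \<infinity>"
    using a by (simp add: objective_def set_indicator_def)
  ultimately show ?thesis by (simp add: regular_subdiff_def)
qed

text \<open>In the minimality inequality of a step against a fixed \<open>u\<close>, both sides depend continuously on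
  the iterates. For the weights \<open>\<phi>'\<^sub>+(|v\<^sub>i|)\<close> this rests on the continuity of \<open>\<phi>'\<^sub>+\<close> up to \<open>0\<close>.\<close>

lemma proximal_step_limit:
  fixes grad :: "real ^ 'n \<Rightarrow> real ^ 'n"
  assumes cont: "continuous_on UNIV grad"
    and lims: "p \<longlonglongrightarrow> a" "q \<longlonglongrightarrow> a" "v \<longlonglongrightarrow> a"
    and min: "\<And>j. is_arg_min (\<lambda>u. inner (grad (q j)) (u - q j) + L / 2 * (norm (u - q j))\<^sup>2
                 + weighted_l1 (right_deriv_vec \<phi> \<bar>v j\<bar>) u) (\<lambda>u. u \<in> C) (p j)"
    and u: "u \<in> C"
  shows "weighted_l1 (right_deriv_vec \<phi> \<bar>a\<bar>) a
      \<le> inner (grad a) (u - a) + L / 2 * (norm (u - a))\<^sup>2 + weighted_l1 (right_deriv_vec \<phi> \<bar>a\<bar>) u"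
proof -
  let ?J = "\<lambda>j u. inner (grad (q j)) (u - q j) + L / 2 * (norm (u - q j))\<^sup>2
                 + weighted_l1 (right_deriv_vec \<phi> \<bar>v j\<bar>) u"
  have grad_lim: "(\<lambda>j. grad (q j)) \<longlonglongrightarrow> grad a"
    using continuous_on_tendsto_compose[OF cont lims(2)] by simp
  have weight_lim: "(\<lambda>j. right_deriv \<phi> \<bar>v j $ i\<bar>) \<longlonglongrightarrow> right_deriv \<phi> \<bar>a $ i\<bar>" for i
    by (rule continuous_on_tendsto_compose[OF continuous_on_right_deriv])
      (auto intro!: tendsto_intros lims)
  have lim: "(\<lambda>j. ?J j (b j)) \<longlonglongrightarrow> inner (grad a) (b' - a) + L / 2 * (norm (b' - a))\<^sup>2
      + weighted_l1 (right_deriv_vec \<phi> \<bar>a\<bar>) b'" if "b \<longlonglongrightarrow> b'" for b b'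
    unfolding weighted_l1_def right_deriv_vec_def abs_vec_def
    using that by (auto intro!: tendsto_intros lims grad_lim weight_lim)
  have "?J j (p j) \<le> ?J j u" for j
    using min[of j] u by (auto simp: is_arg_min_def not_less)
  then have "inner (grad a) (a - a) + L / 2 * (norm (a - a))\<^sup>2 + weighted_l1 (right_deriv_vec \<phi> \<bar>a\<bar>) a
      \<le> inner (grad a) (u - a) + L / 2 * (norm (u - a))\<^sup>2 + weighted_l1 (right_deriv_vec \<phi> \<bar>a\<bar>) u"
    by (intro LIMSEQ_le[OF lim[OF lims(1)] lim[OF tendsto_const]]) auto
  then show ?thesis by simp
qed

end

lemma regular_subdiff_subset_limiting: "regular_subdiff g x \<subseteq> limiting_subdiff g x"
proof
  fix \<zeta> assume "\<zeta> \<in> regular_subdiff g x"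
  then show "\<zeta> \<in> limiting_subdiff g x"
    unfolding limiting_subdiff_def
    by (intro CollectI conjI exI[of _ "\<lambda>_. x"] exI[of _ "\<lambda>_. \<zeta>"]) (auto simp: regular_subdiff_def)
qed

section \<open>Convergence of the algorithm\<close>

text \<open>Cauchy--Schwarz with weights: multiplied by \<open>\<gamma> (1 - \<gamma>)\<close>, the gap between
  \<open>(\<parallel>a\<parallel> + \<parallel>b\<parallel>)\<^sup>2\<close> and the right-hand side is the square of \<open>\<gamma> \<parallel>a\<parallel> - (1 - \<gamma>) \<parallel>b\<parallel>\<close>.\<close>

lemma norm_add_square_le_weighted:
  fixes a b :: "'a::real_normed_vector"
  assumes "0 < \<gamma>" "\<gamma> < 1"
  shows "(norm (a + b))\<^sup>2 \<le> (norm a)\<^sup>2 / (1 - \<gamma>) + (norm b)\<^sup>2 / \<gamma>"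
proof -
  have "(norm (a + b))\<^sup>2 \<le> (norm a + norm b)\<^sup>2"
    by (intro power_mono norm_triangle_ineq norm_ge_zero)
  also have "\<dots> \<le> (norm a)\<^sup>2 / (1 - \<gamma>) + (norm b)\<^sup>2 / \<gamma>"
  proof -
    have "(\<gamma> * (1 - \<gamma>)) * (norm a + norm b)\<^sup>2 + (\<gamma> * norm a - (1 - \<gamma>) * norm b)\<^sup>2
        = \<gamma> * (norm a)\<^sup>2 + (1 - \<gamma>) * (norm b)\<^sup>2"
      by algebra
    moreover have "(\<gamma> * (1 - \<gamma>)) * ((norm a)\<^sup>2 / (1 - \<gamma>) + (norm b)\<^sup>2 / \<gamma>)
        = \<gamma> * (norm a)\<^sup>2 + (1 - \<gamma>) * (norm b)\<^sup>2"
      using assms by (simp add: distrib_left)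
    moreover have "0 \<le> (\<gamma> * norm a - (1 - \<gamma>) * norm b)\<^sup>2" by simp
    ultimately have "(\<gamma> * (1 - \<gamma>)) * (norm a + norm b)\<^sup>2
        \<le> (\<gamma> * (1 - \<gamma>)) * ((norm a)\<^sup>2 / (1 - \<gamma>) + (norm b)\<^sup>2 / \<gamma>)" by linarith
    then show ?thesis using assms by simp
  qed
  finally show ?thesis .
qed

theorem theorem5p1:
  fixes f :: "real ^ 'n \<Rightarrow> real"
    and grad :: "real ^ 'n \<Rightarrow> real ^ 'n"
    and L :: real
    and C :: "(real ^ 'n) set"
    and \<phi> :: "real \<Rightarrow> real"
    and l :: real
    and \<theta> :: "nat \<Rightarrow> real"
    and \<gamma> :: real
    and s x y z w :: "nat \<Rightarrow> real ^ 'n"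
  assumes f_convex: "convex_on UNIV f"
    and f_grad: "\<And>u. GDERIV f u :> grad u"
    and grad_cont: "continuous_on UNIV grad"
    and L_pos: "L > 0"
    and grad_lip: "L-lipschitz_on UNIV grad"
    and C_ne: "C \<noteq> {}"
    and C_closed: "closed C"
    and C_convex: "convex C"
    and phi_nonneg: "\<And>t. t \<ge> 0 \<Longrightarrow> \<phi> t \<ge> 0"
    and phi_cont: "continuous_on {0..} \<phi>"
    and phi_concave: "concave_on {0..} \<phi>"
    and phi_0: "\<phi> 0 = 0"
    and phi_diff: "\<And>t. t > 0 \<Longrightarrow> \<phi> field_differentiable at t"
    and phi_deriv_cont: "continuous_on {0<..} (deriv \<phi>)"
    and phi_deriv_lim: "(deriv \<phi> \<longlongrightarrow> l) (at_right 0)"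
    and F_level: "level_bounded (objective f C \<phi>)"
    and theta_range: "\<And>k. 0 < \<theta> k \<and> \<theta> k \<le> 1"
    and gamma_range: "0 < \<gamma>" "\<gamma> < 1"
    and theta_sup:
      "(SUP k\<in>{1..}. max ((\<theta> k)\<^sup>2 * (1 - \<theta> (k - 1))\<^sup>2 / \<gamma> - (\<theta> (k - 1))\<^sup>2)
                          ((\<theta> k)\<^sup>2 / (1 - \<gamma>) - 1)) < 0"
    and alg: "IRL1e3 grad L C \<phi> \<theta> s x y z"
    and w_def: "\<And>k. w (Suc k) = (1 - \<theta> k) *\<^sub>R x k + \<theta> k *\<^sub>R z (Suc k)"
  shows "(\<forall>k\<ge>1. \<bar>H3 f C \<phi> L (x k) (x (k - 1)) (w k)\<bar> \<noteq> \<infinity>) \<and>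
    (\<forall>k\<ge>1. H3 f C \<phi> L (x (k + 1)) (x k) (w (k + 1)) \<le> H3 f C \<phi> L (x k) (x (k - 1)) (w k)) \<and>
    (\<exists>h::real. (\<lambda>k. H3 f C \<phi> L (x k) (x (k - 1)) (w k)) \<longlonglongrightarrow> ereal h) \<and>
    (\<exists>D>0. \<forall>k\<ge>1.
           H3 f C \<phi> L (x k) (x (k - 1)) (w k) - H3 f C \<phi> L (x (k + 1)) (x k) (w (k + 1))
             \<ge> ereal (D * ((norm (x (k - 1) - z k))\<^sup>2 + (norm (w k - x k))\<^sup>2))) \<and>
    (bounded (range x)) \<and>
    ((\<lambda>k. Max {norm (x (k - 1) - z k), norm (w k - x k),
                   norm (x k - x (k - 1)), norm (x k - y (k - 1))}) \<longlonglongrightarrow> 0) \<and>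
    (\<forall>a. (\<exists>r. strict_mono r \<and> (x \<circ> r) \<longlonglongrightarrow> a) \<longrightarrow> 0 \<in> limiting_subdiff (objective f C \<phi>) a)"
proof -
  interpret concave_penalty \<phi> l
    using phi_nonneg phi_cont phi_concave phi_diff phi_deriv_cont phi_deriv_lim
    by unfold_locales
  note iteration = alg[unfolded IRL1e3_def, THEN conjunct2, THEN conjunct2, THEN spec]
  have s: "s (Suc k) = right_deriv_vec \<phi> \<bar>x k\<bar>"
    and y: "y k = (1 - \<theta> k) *\<^sub>R x k + \<theta> k *\<^sub>R z k" for k
    using iteration[of k] by blast+
  have zmin: "is_arg_min (\<lambda>u. inner (grad (y k)) (u - y k) + L * \<theta> k / 2 * (norm (u - z k))\<^sup>2
                  + weighted_l1 (right_deriv_vec \<phi> \<bar>x k\<bar>) u) (\<lambda>u. u \<in> C) (z (Suc k))"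
    and xmin: "is_arg_min (\<lambda>u. inner (grad (y k)) (u - y k) + L / 2 * (norm (u - y k))\<^sup>2
                  + weighted_l1 (right_deriv_vec \<phi> \<bar>x k\<bar>) u) (\<lambda>u. u \<in> C) (x (Suc k))" for k
    using iteration[of k] unfolding weighted_l1_def s[symmetric] by blast+
  have xC: "x k \<in> C" for k
    using alg xmin by (cases k) (auto simp: IRL1e3_def is_arg_min_def)
  have \<theta>: "0 < \<theta> k" "\<theta> k \<le> 1" for k
    using theta_range by auto

  define R where "R u = f u + sep_sum \<phi> \<bar>u\<bar>" for u
  \<comment> \<open>\<open>H\<close>, \<open>p\<close> and \<open>q\<close> carry the index \<open>k\<close> for quantities of step \<open>k + 1\<close>, since \<open>w\<close> is determined
    from index \<open>1\<close> on only\<close>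
  define H where "H k = R (x (Suc k)) + L / 2 * (norm (w (Suc k) - x k))\<^sup>2
      + L / 2 * (norm (w (Suc k) - x (Suc k)))\<^sup>2" for k
  define p where "p k = norm (x k - z (Suc k))" for k
  define q where "q k = norm (w (Suc k) - x (Suc k))" for k
  have H3_eq: "H3 f C \<phi> L (x (Suc k)) (x k) (w (Suc k)) = ereal (H k)" for k
    using xC[of "Suc k"] by (simp add: H3_def H_def R_def set_indicator_def)

  have wx: "norm (w (Suc k) - x k) = \<theta> k * p k" for k
  proof -
    have "w (Suc k) - x k = \<theta> k *\<^sub>R (z (Suc k) - x k)" by (simp add: w_def algebra_simps)
    then show ?thesis using \<theta>(1)[of k] by (simp add: p_def norm_minus_commute)
  qed
  have wz: "w (Suc k) - z (Suc k) = (1 - \<theta> k) *\<^sub>R (x k - z (Suc k))" for k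
    by (simp add: w_def algebra_simps)

  have step: "H k \<le> R (x k) + L / 2 * ((\<theta> k)\<^sup>2 * (norm (x k - z k))\<^sup>2)" for k
  proof -
    have "0 \<le> right_deriv_vec \<phi> \<bar>x k\<bar> $ i" for i
      by (simp add: right_deriv_vec_def right_deriv_nonneg abs_vec_def)
    from accelerated_step_decrease[OF f_convex f_grad grad_lip C_convex xC this
        less_imp_le[OF \<theta>(1)] \<theta>(2) y zmin xmin w_def]
    show ?thesis
      using sep_sum_majorized[of "x (Suc k)" "x k"] by (simp add: H_def R_def)
  qed

  let ?M = "\<lambda>k. max ((\<theta> k)\<^sup>2 * (1 - \<theta> (k - 1))\<^sup>2 / \<gamma> - (\<theta> (k - 1))\<^sup>2) ((\<theta> k)\<^sup>2 / (1 - \<gamma>) - 1)"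
  define S where "S = (SUP k\<in>{1..}. ?M k)"
  define D where "D = L / 2 * (- S)"
  have D: "0 < D" using theta_sup L_pos by (simp add: D_def S_def mult_pos_neg)
  \<comment> \<open>boundedness above is what makes the real supremum an upper bound\<close>
  have M_le: "?M (Suc k) \<le> S" for k
    unfolding S_def
  proof (rule cSUP_upper)
    have "?M k \<le> 1 / \<gamma> + 1 / (1 - \<gamma>)" for k
    proof -
      have sq: "(\<theta> k)\<^sup>2 \<le> 1" "(1 - \<theta> (k - 1))\<^sup>2 \<le> 1"
        using \<theta>[of k] \<theta>[of "k - 1"] by (auto simp: power_le_one)
      then have "(\<theta> k)\<^sup>2 * (1 - \<theta> (k - 1))\<^sup>2 / \<gamma> \<le> 1 / \<gamma>" "(\<theta> k)\<^sup>2 / (1 - \<gamma>) \<le> 1 / (1 - \<gamma>)"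
        using gamma_range by (auto intro!: divide_right_mono mult_le_one)
      moreover have "0 \<le> 1 / \<gamma>" "0 \<le> 1 / (1 - \<gamma>)" using gamma_range by auto
      ultimately show ?thesis
        by (smt (verit) zero_le_power2)
    qed
    then show "bdd_above (?M ` {1..})"
      by (intro bdd_aboveI2)
  qed simp

  have decrease: "D * ((p k)\<^sup>2 + (q k)\<^sup>2) \<le> H k - H (Suc k)" for k
  proof -
    define t t' where "t = \<theta> k" and "t' = \<theta> (Suc k)"
    have "(norm (x (Suc k) - z (Suc k)))\<^sup>2
        = (norm ((x (Suc k) - w (Suc k)) + (w (Suc k) - z (Suc k))))\<^sup>2"
      by simp
    also have "\<dots> \<le> (q k)\<^sup>2 / (1 - \<gamma>) + ((1 - t)\<^sup>2 * (p k)\<^sup>2) / \<gamma>"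
      using norm_add_square_le_weighted[OF gamma_range, of "x (Suc k) - w (Suc k)" "w (Suc k) - z (Suc k)"]
      by (simp add: wz p_def q_def t_def power_mult_distrib norm_minus_commute[of "w (Suc k)"])
    finally have "t'\<^sup>2 * (norm (x (Suc k) - z (Suc k)))\<^sup>2
        \<le> t'\<^sup>2 * ((q k)\<^sup>2 / (1 - \<gamma>) + ((1 - t)\<^sup>2 * (p k)\<^sup>2) / \<gamma>)"
      by (intro mult_left_mono) auto
    also have "\<dots> = t\<^sup>2 * (p k)\<^sup>2 + (q k)\<^sup>2 + (t'\<^sup>2 * (1 - t)\<^sup>2 / \<gamma> - t\<^sup>2) * (p k)\<^sup>2
        + (t'\<^sup>2 / (1 - \<gamma>) - 1) * (q k)\<^sup>2"
      by (simp add: algebra_simps)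
    also have "\<dots> \<le> t\<^sup>2 * (p k)\<^sup>2 + (q k)\<^sup>2 + S * (p k)\<^sup>2 + S * (q k)\<^sup>2"
      using M_le[of k] by (intro add_mono mult_right_mono) (auto simp: t_def t'_def)
    finally have "L / 2 * (t'\<^sup>2 * (norm (x (Suc k) - z (Suc k)))\<^sup>2)
        \<le> L / 2 * (t\<^sup>2 * (p k)\<^sup>2 + (q k)\<^sup>2 + S * (p k)\<^sup>2 + S * (q k)\<^sup>2)"
      using L_pos by (intro mult_left_mono) auto
    moreover have "H k = R (x (Suc k)) + L / 2 * (t\<^sup>2 * (p k)\<^sup>2) + L / 2 * (q k)\<^sup>2"
      unfolding H_def wx by (simp add: q_def t_def power_mult_distrib)
    ultimately show ?thesis
      using step[of "Suc k"] unfolding D_def t'_def[symmetric]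
      by (simp add: distrib_left distrib_right add_divide_distrib)
  qed
  have H_Suc: "H (Suc k) \<le> H k" for k
  proof -
    have "0 \<le> D * ((p k)\<^sup>2 + (q k)\<^sup>2)" using D by simp
    with decrease[of k] show ?thesis by simp
  qed
  then have H_dec: "decseq H" by (simp add: decseq_Suc_iff)

  have R_le_H: "R (x (Suc k)) \<le> H k" for k
    using L_pos by (simp add: H_def)
  have bounded_x: "bounded (range x)"
  proof -
    have "bounded {u. objective f C \<phi> u \<le> ereal (H 0)}"
      using F_level by (simp add: level_bounded_def)
    then have "bounded (insert (x 0) {u. objective f C \<phi> u \<le> ereal (H 0)})" by simp
    moreover have "range x \<subseteq> insert (x 0) {u. objective f C \<phi> u \<le> ereal (H 0)}"
    proof clarsimp
      fix k assume "x k \<noteq> x 0"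
      then obtain m where m: "k = Suc m" by (cases k) auto
      have "R (x (Suc m)) \<le> H 0"
        using R_le_H[of m] decseqD[OF H_dec, of 0 m] by simp
      then show "objective f C \<phi> (x k) \<le> ereal (H 0)"
        using xC[of k] by (simp add: m objective_def set_indicator_def R_def)
    qed
    ultimately show ?thesis by (rule bounded_subset)
  qed

  obtain h where h: "H \<longlonglongrightarrow> h"
  proof -
    have "continuous_on UNIV f"
      using f_grad unfolding gderiv_def
      by (meson continuous_at_imp_continuous_on has_derivative_continuous)
    then have "compact (f ` closure (range x))"
      using bounded_x by (intro compact_continuous_image)
        (auto intro: continuous_on_subset simp: compact_closure)
    then obtain B where B: "\<forall>u\<in>closure (range x). \<bar>f u\<bar> \<le> B"
      by (auto dest!: compact_imp_bounded simp: bounded_iff)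
    have "- B \<le> H k" for k
    proof -
      have "\<bar>f (x (Suc k))\<bar> \<le> B" using B closure_subset[of "range x"] by blast
      moreover have "0 \<le> sep_sum \<phi> \<bar>x (Suc k)\<bar>"
        by (auto simp: sep_sum_def abs_vec_def intro!: sum_nonneg nonneg)
      ultimately show ?thesis using R_le_H[of k] by (simp add: R_def)
    qed
    then show ?thesis using decseq_convergent[OF H_dec, of "- B"] that by blast
  qed

  have pq_sq: "(\<lambda>k. (p k)\<^sup>2 + (q k)\<^sup>2) \<longlonglongrightarrow> 0"
  proof (rule tendsto_sandwich[OF _ _ tendsto_const])
    have "(\<lambda>k. (H k - H (Suc k)) / D) \<longlonglongrightarrow> (h - h) / D"
      using D by (intro tendsto_intros h LIMSEQ_Suc[OF h]) auto
    then show "(\<lambda>k. (H k - H (Suc k)) / D) \<longlonglongrightarrow> 0" by simp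
    show "eventually (\<lambda>k. (p k)\<^sup>2 + (q k)\<^sup>2 \<le> (H k - H (Suc k)) / D) sequentially"
      using decrease D by (simp add: pos_le_divide_eq mult.commute)
  qed simp
  have p_lim: "p \<longlonglongrightarrow> 0" and q_lim: "q \<longlonglongrightarrow> 0"
  proof -
    have "(\<lambda>k. (p k)\<^sup>2) \<longlonglongrightarrow> 0" "(\<lambda>k. (q k)\<^sup>2) \<longlonglongrightarrow> 0"
      by (rule tendsto_sandwich[OF _ _ tendsto_const pq_sq]; simp)+
    from this[THEN tendsto_real_sqrt] show "p \<longlonglongrightarrow> 0" "q \<longlonglongrightarrow> 0"
      by (simp_all add: p_def[abs_def] q_def[abs_def])
  qed

  have x_step: "norm (x (Suc k) - x k) \<le> p k + q k" for k
  proof -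
    have "norm (x (Suc k) - x k) \<le> norm (x (Suc k) - w (Suc k)) + norm (w (Suc k) - x k)"
      using norm_triangle_ineq[of "x (Suc k) - w (Suc k)" "w (Suc k) - x k"] by simp
    also have "\<dots> \<le> q k + p k"
      using \<theta>[of k] wx[of k] by (simp add: q_def norm_minus_commute p_def mult_left_le_one_le)
    finally show ?thesis by simp
  qed
  \<comment> \<open>\<open>y\<^sup>k\<close> involves \<open>z\<^sup>k\<close>, which is controlled through \<open>w\<^sup>k\<close>, hence by the previous step as well\<close>
  have xy_step: "norm (x (Suc (Suc k)) - y (Suc k)) \<le> (p (Suc k) + q (Suc k)) + (p k + q k)" for k
  proof -
    have "norm (x (Suc k) - z (Suc k)) \<le> norm (x (Suc k) - w (Suc k)) + norm (w (Suc k) - z (Suc k))"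
      using norm_triangle_ineq[of "x (Suc k) - w (Suc k)" "w (Suc k) - z (Suc k)"] by simp
    also have "\<dots> \<le> q k + p k"
      using \<theta>[of k] by (simp add: wz q_def norm_minus_commute p_def mult_left_le_one_le)
    finally have xz: "norm (x (Suc k) - z (Suc k)) \<le> p k + q k" by simp
    have "x (Suc k) - y (Suc k) = \<theta> (Suc k) *\<^sub>R (x (Suc k) - z (Suc k))"
      by (simp add: y algebra_simps)
    then have "norm (x (Suc k) - y (Suc k)) \<le> norm (x (Suc k) - z (Suc k))"
      using \<theta>[of "Suc k"] by (simp add: mult_left_le_one_le)
    with xz x_step[of "Suc k"] show ?thesis
      using norm_triangle_ineq[of "x (Suc (Suc k)) - x (Suc k)" "x (Suc k) - y (Suc k)"] by simp
  qed

  let ?V = "\<lambda>k. Max {norm (x (k - 1) - z k), norm (w k - x k),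
                   norm (x k - x (k - 1)), norm (x k - y (k - 1))}"
  have V_lim: "?V \<longlonglongrightarrow> 0"
  proof (rule LIMSEQ_offset[of _ 2], rule tendsto_sandwich[OF _ _ tendsto_const])
    have "(\<lambda>k. (p (Suc k) + q (Suc k)) + (p k + q k)) \<longlonglongrightarrow> (0 + 0) + (0 + 0)"
      by (intro tendsto_intros p_lim q_lim LIMSEQ_Suc)
    then show "(\<lambda>k. (p (Suc k) + q (Suc k)) + (p k + q k)) \<longlonglongrightarrow> 0" by simp
    have nn: "0 \<le> p k" "0 \<le> q k" for k by (simp_all add: p_def q_def)
    have "?V (k + 2) \<le> (p (Suc k) + q (Suc k)) + (p k + q k)" for k
      using xy_step[of k] x_step[of "Suc k"] nn[of k] nn[of "Suc k"]
      by (simp add: p_def[of "Suc k"] q_def[of "Suc k"])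
    then show "eventually (\<lambda>k. ?V (k + 2) \<le> (p (Suc k) + q (Suc k)) + (p k + q k)) sequentially"
      by simp
  qed (simp add: le_max_iff_disj)

  have stationary: "0 \<in> limiting_subdiff (objective f C \<phi>) a"
    if r: "strict_mono r" "(x \<circ> r) \<longlonglongrightarrow> a" for a and r :: "nat \<Rightarrow> nat"
  proof -
    \<comment> \<open>drop the first index, so that \<open>r (Suc j) = m j + 1\<close> is the outcome of step \<open>m j\<close>\<close>
    define m where "m j = r (Suc j) - 1" for j
    have r_eq: "r (Suc j) = Suc (m j)" for j
      using strict_mono_less[OF r(1), of 0 "Suc j"] by (simp add: m_def)
    have m_mono: "strict_mono m"
      using strict_mono_less[OF r(1)] r_eq by (auto simp: strict_mono_def) (metis Suc_less_eq)
    have xm: "(\<lambda>j. x (Suc (m j))) \<longlonglongrightarrow> a"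
      using LIMSEQ_Suc[OF r(2)] by (simp add: r_eq)
    have "(\<lambda>j. ?V (Suc (m j))) \<longlonglongrightarrow> 0"
      using LIMSEQ_subseq_LIMSEQ[OF LIMSEQ_Suc[OF V_lim] m_mono] by (simp add: comp_def)
    then have "(\<lambda>j. x (Suc (m j)) - x (m j)) \<longlonglongrightarrow> 0" "(\<lambda>j. x (Suc (m j)) - y (m j)) \<longlonglongrightarrow> 0"
      by (rule Lim_null_comparison[rotated]; simp add: le_max_iff_disj)+
    from this[THEN tendsto_diff[OF xm]]
    have xm': "(\<lambda>j. x (m j)) \<longlonglongrightarrow> a" and ym: "(\<lambda>j. y (m j)) \<longlonglongrightarrow> a" by simp_all
    have "a \<in> C"
      using closed_sequentially[OF C_closed _ xm] xC by simp
    moreover note proximal_step_limit[OF grad_cont xm ym xm' xmin]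
    ultimately have "0 \<in> regular_subdiff (objective f C \<phi>) a"
      by (intro regular_stationary[OF f_convex f_grad L_pos])
    then show ?thesis using regular_subdiff_subset_limiting by blast
  qed

  have H3_lim: "(\<lambda>k. H3 f C \<phi> L (x k) (x (k - 1)) (w k)) \<longlonglongrightarrow> ereal h"
    by (rule LIMSEQ_imp_Suc) (use h in \<open>simp add: H3_eq\<close>)
  have H3_drop: "ereal (D * ((norm (x (k - 1) - z k))\<^sup>2 + (norm (w k - x k))\<^sup>2))
      \<le> H3 f C \<phi> L (x k) (x (k - 1)) (w k) - H3 f C \<phi> L (x (k + 1)) (x k) (w (k + 1))"
    if "1 \<le> k" for k
    using that decrease by (cases k) (simp_all add: H3_eq p_def q_def)
  show ?thesis
  proof (intro conjI allI impI)
    fix k :: nat assume k: "1 \<le> k"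
    show "\<bar>H3 f C \<phi> L (x k) (x (k - 1)) (w k)\<bar> \<noteq> \<infinity>"
      using k by (cases k) (simp_all add: H3_eq)
    show "H3 f C \<phi> L (x (k + 1)) (x k) (w (k + 1)) \<le> H3 f C \<phi> L (x k) (x (k - 1)) (w k)"
      using k H_Suc by (cases k) (simp_all add: H3_eq)
  next
    fix a assume "\<exists>r. strict_mono r \<and> (x \<circ> r) \<longlonglongrightarrow> a"
    then show "0 \<in> limiting_subdiff (objective f C \<phi>) a" using stationary by blast
  qed (use D H3_drop H3_lim bounded_x V_lim in blast)+
qed

end
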